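(* Let $G$ be a connected graph on vertex set $[n]$ and $G^{w}$ a dual number weighted graph of $G$ with Laplacian matrix $L_w$. Let $\widetilde{L}_{11}=L_{11}+\widehat{L}_{11}\varepsilon\in\mathbb{D}^{(n-1)\times(n-1)}$ be the submatrix of $L_w$ obtained by deleting its $n$-th row and $n$-th column ($L_{11},\widehat{L}_{11}$ real). Then $L_{11}$ is invertible and: (a) for $i,j\in[n-1]$, $R_{ij}(G^{w})=(L_{11}^{-1})_{ii}+(L_{11}^{-1})_{jj}-2(L_{11}^{-1})_{ij}-\big((L_{11}^{-1}\widehat{L}_{11}L_{11}^{-1})_{ii}+(L_{11}^{-1}\widehat{L}_{11}L_{11}^{-1})_{jj}-2(L_{11}^{-1}\widehat{L}_{11}L_{11}^{-1})_{ij}\big)\varepsilon$, and $(L_{11}^{-1})_{ii}+(L_{11}^{-1})_{jj}-2(L_{11}^{-1})_{ij}=R_{ij}(G)$; (b) for $i\in[n-1]$, $R_{in}(G^{w})=(L_{11}^{-1})_{ii}-(L_{11}^{-1}\widehat{L}_{11}L_{11}^{-1})_{ii}\varepsilon$, and $(L_{11}^{-1})_{ii}=R_{in}(G)$; (c) $Kf(G^{w})=n\,\mathrm{tr}(L_{11}^{-1})-\mathbf{1}^{T}L_{11}^{-1}\mathbf{1}-\big(n\,\mathrm{tr}(L_{11}^{-1}\widehat{L}_{11}L_{11}^{-1})-\mathbf{1}^{T}L_{11}^{-1}\widehat{L}_{11}L_{11}^{-1}\mathbf{1}\big)\varepsilon$, and $n\,\mathrm{tr}(L_{11}^{-1})-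\mathbf{1}^{T}L_{11}^{-1}\mathbf{1}=Kf(G)$.
   Context: Dual numbers: $\mathbb{D}=\{a_s+a_d\varepsilon: a_s,a_d\in\mathbb{R}\}$ with $\varepsilon\neq 0$, $\varepsilon^2=0$. $\mathbf{1}$ is the all-ones vector of length $n-1$. Dual number weighted graph: given $G=(V,E)$, $V=[n]$, and reals $\widehat{a}_e$ ($e\in E$), edge $e$ gets conductance $w(e)=1+\widehat{a}_e\varepsilon$. $L=D-A$ is the Laplacian of $G$; the perturbation Laplacian is $\widehat{L}=\widehat{D}-\widehat{A}$ where $\widehat{A}_{ij}=\widehat{a}_e$ if $e=\{i,j\}\in E$ and $0$ otherwise, and $\widehat{D}$ is diagonal with $\widehat{D}_{ii}=\sum_j\widehat{A}_{ij}$; the Laplacian of $G^w$ is $L_w=L+\widehat{L}\varepsilon$ (so $L_{11}$, $\widehat{L}_{11}$ are the leading $(n-1)\times(n-1)$ principal submatrices of $L$, $\widehat{L}$). Resistance distance: $R_{ij}(G)$ is the effective resistance between $i,j$ with unit resistors on all edges of $G$; $R_{ij}(G^w)$ is the effective resistance in $G^w$: $R_{ii}(G^w)=0$, and for $i\ne j$, with net current $Y>0$ entering at $i$ and leaving at $j$, node potentials $v\in\mathbb{D}^n$ satisfy $L_wv=Y(\mathbf{1}_i-\mathbf{1}_j)$ ($\mathbf{1}_k$ the $k$-th standard basis vector of length $n$) and $R_{ij}(G^w)=(v_i-v_j)/Y$. Kirchhoff index: $Kf(G)=\sum_{i<j}R_{ij}(G)$ and $Kf(G^w)=\sum_{i<j}R_{ij}(G^w)$.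 *)

theory Defs
  imports
    Complex_Main
    "Jordan_Normal_Form.Determinant"
    "Jordan_Normal_Form.Gauss_Jordan_Elimination"
begin

datatype dual = Dual (std_part: real) (dual_part: real)

instantiation dual :: comm_ring_1
begin

definition zero_dual :: dual where "0 = Dual 0 0"
definition one_dual :: dual where "1 = Dual 1 0"
definition uminus_dual :: "dual \<Rightarrow> dual" where
  "- x = Dual (- std_part x) (- dual_part x)"
definition plus_dual :: "dual \<Rightarrow> dual \<Rightarrow> dual" where
  "x + y = Dual (std_part x + std_part y) (dual_part x + dual_part y)"
definition minus_dual :: "dual \<Rightarrow> dual \<Rightarrow> dual" where
  "x - y = Dual (std_part x - std_part y) (dual_part x - dual_part y)"
definition times_dual :: "dual \<Rightarrow> dual \<Rightarrow> dual" where
  "x * y = Dual (std_part x * std_part y)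
                (std_part x * dual_part y + dual_part x * std_part y)"

instance
  by standard
    (auto simp: zero_dual_def one_dual_def uminus_dual_def plus_dual_def minus_dual_def
      times_dual_def dual.expand algebra_simps)

end

instantiation dual :: real_algebra_1
begin

definition scaleR_dual :: "real \<Rightarrow> dual \<Rightarrow> dual" where
  "r *\<^sub>R x = Dual (r * std_part x) (r * dual_part x)"

instance
  by standard
    (auto simp: scaleR_dual_def one_dual_def plus_dual_def times_dual_def algebra_simps)

end

definition eps :: dual where "eps = Dual 0 1"

lemma eps_nonzero: "eps \<noteq> 0"
  by (simp add: eps_def zero_dual_def)

lemma eps_square: "eps ^ 2 = 0"
  by (simp add: eps_def zero_dual_def times_dual_def power2_eq_square)

lemma of_real_dual: "of_real r = Dual r 0"
  by (simp add: of_real_def scaleR_dual_def one_dual_def)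

lemma dual_decompose: "x = of_real (std_part x) + of_real (dual_part x) * eps"
  by (cases x) (simp add: of_real_dual eps_def plus_dual_def times_dual_def)

lemma dual_eq_iff:
  "of_real a + of_real b * eps = of_real c + of_real d * eps \<longleftrightarrow> a = c \<and> b = d"
  by (simp add: of_real_dual eps_def plus_dual_def times_dual_def)

definition dual_mat :: "real mat \<Rightarrow> real mat \<Rightarrow> dual mat" where
  "dual_mat A B = map_mat of_real A + eps \<cdot>\<^sub>m map_mat of_real B"

text \<open>Since matrix indices start at 0, the vertex set \<open>[n]\<close> is \<open>{..<n}\<close>; the last vertex
  (the one whose row and column are deleted) has index \<open>n - 1\<close>.\<close>

definition simple_graph :: "nat \<Rightarrow> nat set set \<Rightarrow> bool" where
  "simple_graph n E \<longleftrightarrow> (\<forall>e\<in>E. e \<subseteq> {..<n} \<and> card e = 2)"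

definition connected_graph :: "nat \<Rightarrow> nat set set \<Rightarrow> bool" where
  "connected_graph n E \<longleftrightarrow> (\<forall>u<n. \<forall>v<n. (u, v) \<in> {(x, y). {x, y} \<in> E}\<^sup>*)"

definition adjacency_mat :: "nat \<Rightarrow> nat set set \<Rightarrow> (nat set \<Rightarrow> 'a::ring_1) \<Rightarrow> 'a mat" where
  "adjacency_mat n E w = mat n n (\<lambda>(i, j). if {i, j} \<in> E then w {i, j} else 0)"

definition degree_mat :: "nat \<Rightarrow> nat set set \<Rightarrow> (nat set \<Rightarrow> 'a::ring_1) \<Rightarrow> 'a mat" where
  "degree_mat n E w = mat_diag n (\<lambda>i. \<Sum>j<n. adjacency_mat n E w $$ (i, j))"

definition weighted_laplacian ::
  "nat \<Rightarrow> nat set set \<Rightarrow> (nat set \<Rightarrow> 'a::ring_1) \<Rightarrow> 'a mat" where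
  "weighted_laplacian n E w = degree_mat n E w - adjacency_mat n E w"

definition laplacian :: "nat \<Rightarrow> nat set set \<Rightarrow> real mat" where
  "laplacian n E = weighted_laplacian n E (\<lambda>_. 1)"

definition perturbation_laplacian :: "nat \<Rightarrow> nat set set \<Rightarrow> (nat set \<Rightarrow> real) \<Rightarrow> real mat" where
  "perturbation_laplacian n E a = weighted_laplacian n E a"

definition dual_laplacian :: "nat \<Rightarrow> nat set set \<Rightarrow> (nat set \<Rightarrow> real) \<Rightarrow> dual mat" where
  "dual_laplacian n E a = dual_mat (laplacian n E) (perturbation_laplacian n E a)"

definition conductance :: "(nat set \<Rightarrow> real) \<Rightarrow> nat set \<Rightarrow> dual" where
  "conductance a e = 1 + of_real (a e) * eps"

lemma dual_laplacian_conductance: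
  "dual_laplacian n E a = weighted_laplacian n E (conductance a)"
proof -
  have A: "(if P then conductance a e else 0) =
        of_real (if P then 1 else 0) + eps * of_real (if P then a e else 0)" for P e
    by (simp add: conductance_def mult.commute)
  show ?thesis
    by (rule eq_matI)
      (auto simp: dual_laplacian_def dual_mat_def laplacian_def perturbation_laplacian_def
        weighted_laplacian_def degree_mat_def adjacency_mat_def mat_diag_def A
        sum.distrib sum_distrib_left algebra_simps simp del: of_real_mult)
qed

lemma mat_delete_dual_laplacian_iff:
  assumes "n > 0" "L11 \<in> carrier_mat (n - 1) (n - 1)" "Lh11 \<in> carrier_mat (n - 1) (n - 1)"
  shows "mat_delete (dual_laplacian n E a) (n - 1) (n - 1) = dual_mat L11 Lh11 \<longleftrightarrow>
    L11 = mat_delete (laplacian n E) (n - 1) (n - 1) \<and>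
    Lh11 = mat_delete (perturbation_laplacian n E a) (n - 1) (n - 1)"
proof -
  let ?L = "laplacian n E" and ?P = "perturbation_laplacian n E a"
  have c: "?L \<in> carrier_mat n n" "?P \<in> carrier_mat n n"
    by (auto simp: laplacian_def perturbation_laplacian_def weighted_laplacian_def
        degree_mat_def adjacency_mat_def)
  have "mat_delete (dual_laplacian n E a) (n - 1) (n - 1) =
      dual_mat (mat_delete ?L (n - 1) (n - 1)) (mat_delete ?P (n - 1) (n - 1))"
    using c by (intro eq_matI) (auto simp: dual_laplacian_def dual_mat_def mat_delete_def)
  moreover have inj: "dual_mat A B = dual_mat C D \<longleftrightarrow> A = C \<and> B = D"
    if "A \<in> carrier_mat m m" "B \<in> carrier_mat m m" "C \<in> carrier_mat m m" "D \<in> carrier_mat m m"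
    for A B C D :: "real mat" and m
    using that
    by (auto simp: dual_mat_def mat_eq_iff mult.commute[of eps] dual_eq_iff)
  moreover have "mat_delete ?L (n - 1) (n - 1) \<in> carrier_mat (n - 1) (n - 1)"
    "mat_delete ?P (n - 1) (n - 1) \<in> carrier_mat (n - 1) (n - 1)"
    using c by (auto simp: mat_delete_def)
  ultimately show ?thesis
    using assms inj[of "mat_delete ?L (n - 1) (n - 1)" "n - 1"
        "mat_delete ?P (n - 1) (n - 1)" L11 Lh11] by auto
qed

text \<open>The potentials \<open>v\<close> live in the scalar ring of the Laplacian (the reals or the dual
  numbers); the injected current \<open>Y\<close> is a positive real. For a connected graph, potentials
  exist for every \<open>Y\<close>, and the quotient depends neither on \<open>Y\<close> nor on \<open>v\<close>.\<close>

definition eff_resistance :: "'a::{comm_ring_1, real_algebra_1} mat \<Rightarrow> nat \<Rightarrow> nat \<Rightarrow> 'a" where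
  "eff_resistance L i j =
    (if i = j then 0
     else THE r. \<exists>Y>0. \<exists>v \<in> carrier_vec (dim_row L).
       L *\<^sub>v v = of_real Y \<cdot>\<^sub>v (unit_vec (dim_row L) i - unit_vec (dim_row L) j) \<and>
       r = (v $ i - v $ j) /\<^sub>R Y)"

definition kirchhoff_index :: "'a::{comm_ring_1, real_algebra_1} mat \<Rightarrow> 'a" where
  "kirchhoff_index L = (\<Sum>j<dim_row L. \<Sum>i<j. eff_resistance L i j)"

text \<open>\<open>mat_inverse\<close> returns \<open>None\<close> on singular matrices, where \<open>mat_inv\<close> is unspecified.\<close>

definition mat_inv :: "'a::field mat \<Rightarrow> 'a mat" where
  "mat_inv A = the (mat_inverse A)"

lemma mat_inv:
  assumes A: "A \<in> carrier_mat m m" and inv: "invertible_mat A"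
  shows "mat_inv A \<in> carrier_mat m m" "A * mat_inv A = 1\<^sub>m m" "mat_inv A * A = 1\<^sub>m m"
proof -
  obtain B where B: "A * B = 1\<^sub>m m" "B * A = 1\<^sub>m (dim_row B)"
    using inv A by (auto simp: invertible_mat_def inverts_mat_def)
  have "dim_col B = m" using arg_cong[OF B(1), of dim_col] by simp
  moreover have "dim_row B = m" using arg_cong[OF B(2), of dim_col] A by simp
  ultimately have "A \<in> Units (ring_mat TYPE('a) m ())"
    using A B by (auto simp: Units_def ring_mat_simps intro!: bexI[of _ B])
  then have "mat_inverse A \<noteq> None" using mat_inverse(1)[OF A, where b = "()"] by blast
  then obtain C where "mat_inverse A = Some C" by blast
  then show "mat_inv A \<in> carrier_mat m m" "A * mat_inv A = 1\<^sub>m m" "mat_inv A * A = 1\<^sub>m m"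
    using mat_inverse(2)[OF A] by (auto simp: mat_inv_def)
qed

definition mat_trace :: "'a::comm_monoid_add mat \<Rightarrow> 'a" where
  "mat_trace A = (\<Sum>i<dim_row A. A $$ (i, i))"

definition ones_vec :: "nat \<Rightarrow> 'a::one vec" where
  "ones_vec m = vec m (\<lambda>_. 1)"

end

theory Submission
  imports Defs
begin

text \<open>Grounding the last vertex, i.e. normalising its potential to 0, turns the Kirchhoff equations
  into a linear system with the reduced Laplacian as matrix. Over any commutative ring in which the
  reduced Laplacian has an inverse \<open>X\<close>, this gives \<open>R\<^sub>i\<^sub>j = X\<^sub>i\<^sub>i + X\<^sub>j\<^sub>j - 2 X\<^sub>i\<^sub>j\<close>, with \<open>X\<close> extended by 0
  to the last vertex. The theorem is this formula over the reals and over the dual numbers: since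
  \<open>\<epsilon>\<^sup>2 = 0\<close>, the inverse of \<open>A + B\<epsilon>\<close> is \<open>A\<^sup>-\<^sup>1 - A\<^sup>-\<^sup>1BA\<^sup>-\<^sup>1\<epsilon>\<close>.
  The real reduced Laplacian is invertible because a kernel vector, extended by 0, makes the Dirichlet
  form vanish and is therefore constant on a connected graph.\<close>

section \<open>Inverting matrices of dual numbers\<close>

lemma mult_mat_index_sum:
  assumes "A \<in> carrier_mat m n" "B \<in> carrier_mat n k" "i < m" "j < k"
  shows "(A * B) $$ (i, j) = (\<Sum>l<n. A $$ (i, l) * B $$ (l, j))"
  using assms by (simp add: scalar_prod_def lessThan_atLeast0)

lemma mult_mat_vec_index_sum:
  assumes "A \<in> carrier_mat m n" "v \<in> carrier_vec n" "i < m"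
  shows "(A *\<^sub>v v) $ i = (\<Sum>l<n. A $$ (i, l) * v $ l)"
  using assms by (simp add: scalar_prod_def lessThan_atLeast0)

lemma dual_mat_carrier [simp]:
  "A \<in> carrier_mat m n \<Longrightarrow> B \<in> carrier_mat m n \<Longrightarrow> dual_mat A B \<in> carrier_mat m n"
  by (auto simp: dual_mat_def)

lemma dual_mat_index:
  assumes "A \<in> carrier_mat m n" "B \<in> carrier_mat m n" "i < m" "j < n"
  shows "dual_mat A B $$ (i, j) = of_real (A $$ (i, j)) + of_real (B $$ (i, j)) * eps"
  using assms by (auto simp: dual_mat_def mult.commute)

text \<open>The term \<open>B * D\<close> would carry \<open>eps ^ 2\<close> and vanishes, so the
  dual part obeys a Leibniz rule.\<close>

lemma dual_mat_mult:
  assumes A: "A \<in> carrier_mat m n" and B: "B \<in> carrier_mat m n"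
    and C: "C \<in> carrier_mat n k" and D: "D \<in> carrier_mat n k"
  shows "dual_mat A B * dual_mat C D = dual_mat (A * C) (A * D + B * C)"
proof (rule eq_matI)
  fix i j assume "i < dim_row (dual_mat (A * C) (A * D + B * C))"
    "j < dim_col (dual_mat (A * C) (A * D + B * C))"
  then have ij: "i < m" "j < k" using A B C D by (auto simp: dual_mat_def)
  have prod: "(of_real p + of_real q * eps) * (of_real r + of_real s * eps)
      = of_real (p * r) + of_real (p * s + q * r) * eps" for p q r s
    by (simp add: of_real_dual eps_def plus_dual_def times_dual_def)
  have "(dual_mat A B * dual_mat C D) $$ (i, j)
      = (\<Sum>l<n. dual_mat A B $$ (i, l) * dual_mat C D $$ (l, j))"
    using A B C D ij by (intro mult_mat_index_sum) auto
  also have "\<dots> = (\<Sum>l<n. of_real (A $$ (i, l) * C $$ (l, j))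
      + of_real (A $$ (i, l) * D $$ (l, j) + B $$ (i, l) * C $$ (l, j)) * eps)"
    using ij by (intro sum.cong refl)
      (simp only: lessThan_iff dual_mat_index[OF A B] dual_mat_index[OF C D] prod)
  also have "\<dots> = of_real ((A * C) $$ (i, j)) + of_real ((A * D + B * C) $$ (i, j)) * eps"
    using mult_carrier_mat[OF A D] mult_carrier_mat[OF B C] ij
    by (simp add: mult_mat_index_sum[OF A C] mult_mat_index_sum[OF A D] mult_mat_index_sum[OF B C]
        sum.distrib sum_distrib_right distrib_right del: index_mult_mat)
  also have "\<dots> = dual_mat (A * C) (A * D + B * C) $$ (i, j)"
    using A B C D ij by (intro dual_mat_index[symmetric]) auto
  finally show "(dual_mat A B * dual_mat C D) $$ (i, j)
      = dual_mat (A * C) (A * D + B * C) $$ (i, j)" .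
qed (use A B C D in \<open>auto simp: dual_mat_def\<close>)

lemma dual_mat_one_zero: "dual_mat (1\<^sub>m m) (0\<^sub>m m m) = 1\<^sub>m m"
  by (intro eq_matI) (auto simp: dual_mat_def)

text \<open>The dual numbers are not a field, so the inverse is exhibited explicitly. Its dual part
  is forced: \<open>A * Z + B * M = 0\<close> has the solution \<open>Z = - (M * B * M)\<close>, and
  the same \<open>Z\<close> works on the other side.\<close>

lemma dual_mat_inverse:
  assumes A: "A \<in> carrier_mat m m" and B: "B \<in> carrier_mat m m" and M: "M \<in> carrier_mat m m"
    and AM: "A * M = 1\<^sub>m m" and MA: "M * A = 1\<^sub>m m"
  shows "dual_mat A B * dual_mat M (- (M * B * M)) = 1\<^sub>m m"
    and "dual_mat M (- (M * B * M)) * dual_mat A B = 1\<^sub>m m"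
proof -
  let ?N = "M * B * M"
  have N: "?N \<in> carrier_mat m m" using B M by auto
  have BM: "B * M \<in> carrier_mat m m" and MB: "M * B \<in> carrier_mat m m" using B M by auto
  have "A * ?N = A * (M * (B * M))" using B M by (simp add: assoc_mult_mat[OF M B M])
  also have "\<dots> = A * M * (B * M)" by (rule assoc_mult_mat[OF A M BM, symmetric])
  finally have AN: "A * ?N = B * M" using AM BM left_mult_one_mat[OF BM] by metis
  have NA: "?N * A = M * B"
    using assoc_mult_mat[OF MB M A] MA right_mult_one_mat[OF MB] by metis
  have AN_neg: "A * (- ?N) = - (B * M)"
    using AN uminus_mult_right_mat[of A ?N] A N by auto
  show "dual_mat A B * dual_mat M (- ?N) = 1\<^sub>m m"
    using uminus_l_inv_mat[OF BM] A N BM AN_neg AM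
    by (simp add: dual_mat_mult[OF A B M] dual_mat_one_zero)
  have NA_neg: "- ?N * A = - (M * B)"
    using NA uminus_mult_left_mat[of ?N A] A N by auto
  show "dual_mat M (- ?N) * dual_mat A B = 1\<^sub>m m"
    using add_uminus_minus_mat[OF MB MB] A N MB NA_neg MA
    by (simp add: dual_mat_mult[OF M _ A B] dual_mat_one_zero)
qed

section \<open>Effective resistance and Kirchhoff index from the reduced Laplacian\<close>

text \<open>Transposing \<open>A * X = 1\<close> makes the transpose of \<open>X\<close> a left
  inverse of \<open>A\<close>, and a left inverse coincides with a right inverse.\<close>

lemma inverse_symmetric_mat:
  fixes A X :: "'a::comm_ring_1 mat"
  assumes A: "A \<in> carrier_mat m m" and X: "X \<in> carrier_mat m m"
    and sym: "transpose_mat A = A" and AX: "A * X = 1\<^sub>m m"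
  shows "transpose_mat X = X"
proof -
  have Xt: "transpose_mat X \<in> carrier_mat m m" using X by simp
  have "transpose_mat X * A = 1\<^sub>m m"
    using arg_cong[OF AX, of transpose_mat] transpose_mult[OF A X] sym by simp
  then show ?thesis
    using assoc_mult_mat[OF Xt A X] AX X Xt by simp
qed

text \<open>For \<open>X\<close> inverse to a reduced Laplacian this is the Green function of the
  network grounded at \<open>m\<close>: column \<open>j\<close> lists the potentials for a unit
  current from \<open>j\<close> to \<open>m\<close>. The default 0 is the potential of the ground,
  so pairs involving \<open>m\<close> need no separate formula.\<close>

definition grounded_inverse :: "nat \<Rightarrow> 'a::zero mat \<Rightarrow> nat \<Rightarrow> nat \<Rightarrow> 'a" where
  "grounded_inverse m X i j = (if i < m \<and> j < m then X $$ (i, j) else 0)"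

text \<open>The scalars stay general so that one argument serves the reals and the dual numbers. The
  right inverse yields existence of potentials, the left inverse their uniqueness up to a
  constant.\<close>

locale grounded_laplacian =
  fixes m :: nat and L X :: "'a::{comm_ring_1, real_algebra_1} mat"
  assumes carrier_L: "L \<in> carrier_mat (Suc m) (Suc m)"
    and carrier_X: "X \<in> carrier_mat m m"
    and sym_L: "\<And>i j. i < Suc m \<Longrightarrow> j < Suc m \<Longrightarrow> L $$ (i, j) = L $$ (j, i)"
    and row_sum: "\<And>i. i < Suc m \<Longrightarrow> (\<Sum>j<Suc m. L $$ (i, j)) = 0"
    and right_inverse: "mat_delete L m m * X = 1\<^sub>m m"
    and left_inverse: "X * mat_delete L m m = 1\<^sub>m m"
begin

abbreviation "P \<equiv> grounded_inverse m X"

lemma column_sum: "j < Suc m \<Longrightarrow> (\<Sum>i<Suc m. L $$ (i, j)) = 0"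
  using row_sum[of j] sum.cong[OF refl, of "{..<Suc m}" "\<lambda>i. L $$ (i, j)" "\<lambda>i. L $$ (j, i)"]
  by (simp add: sym_L del: sum.lessThan_Suc)

lemma mat_delete_carrier: "mat_delete L m m \<in> carrier_mat m m"
  using carrier_L by (auto simp: mat_delete_def)

lemma mat_delete_entry: "i < m \<Longrightarrow> j < m \<Longrightarrow> mat_delete L m m $$ (i, j) = L $$ (i, j)"
  using carrier_L by (auto simp: mat_delete_def)

lemma right_inverse_entry:
  assumes "i < m" "j < m"
  shows "(\<Sum>k<m. L $$ (i, k) * X $$ (k, j)) = (if i = j then 1 else 0)"
  using arg_cong[OF right_inverse, of "\<lambda>B. B $$ (i, j)"] assms
    mult_mat_index_sum[OF mat_delete_carrier carrier_X, of i j]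
  by (simp add: mat_delete_entry)

lemma left_inverse_entry:
  assumes "i < m" "j < m"
  shows "(\<Sum>k<m. X $$ (i, k) * L $$ (k, j)) = (if i = j then 1 else 0)"
  using arg_cong[OF left_inverse, of "\<lambda>B. B $$ (i, j)"] assms
    mult_mat_index_sum[OF carrier_X mat_delete_carrier, of i j]
  by (simp add: mat_delete_entry)

text \<open>Symmetry lets the two mixed terms of the resistance merge into
  \<open>2 * P i j\<close>.\<close>

lemma P_sym: "P i j = P j i"
proof -
  have "transpose_mat (mat_delete L m m) = mat_delete L m m"
    using carrier_L sym_L by (intro eq_matI) (auto simp: mat_delete_entry)
  then have "transpose_mat X = X"
    using inverse_symmetric_mat mat_delete_carrier carrier_X right_inverse by blast
  then have "X $$ (i, j) = X $$ (j, i)" if "i < m" "j < m"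
    using that carrier_X by (metis carrier_matD index_transpose_mat(1))
  then show ?thesis by (auto simp: grounded_inverse_def)
qed

section \<open>Existence and uniqueness of potentials\<close>

lemmas mult_vec_entry = mult_mat_vec_index_sum[OF carrier_L]

text \<open>For \<open>i = m\<close> both sides are 0, since \<open>k < m\<close>. Row
  \<open>k = m\<close> must be excluded: there the product is -1 for \<open>i < m\<close>, the
  current leaving through the ground.\<close>

lemma L_mult_P:
  assumes "k < m" "i < Suc m"
  shows "(\<Sum>l<Suc m. L $$ (k, l) * P l i) = (if k = i then 1 else 0)"
  using assms right_inverse_entry[of k i]
  by (cases "i < m") (auto simp: grounded_inverse_def)

text \<open>Superposition: a unit current from \<open>i\<close> to the ground minus one from
  \<open>j\<close> to the ground. The equations in rows below \<open>m\<close> come from the right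
  inverse, the last one from conservation of current.\<close>

lemma potential_exists:
  assumes ij: "i < Suc m" "j < Suc m"
  shows "L *\<^sub>v vec (Suc m) (\<lambda>k. P k i - P k j) = unit_vec (Suc m) i - unit_vec (Suc m) j"
proof (rule eq_vecI)
  let ?v = "vec (Suc m) (\<lambda>k. P k i - P k j)"
  let ?e = "unit_vec (Suc m) i - unit_vec (Suc m) j :: 'a vec"
  have v: "?v \<in> carrier_vec (Suc m)" by simp
  have inner: "(L *\<^sub>v ?v) $ k = ?e $ k" if "k < m" for k
  proof -
    have "(L *\<^sub>v ?v) $ k = (\<Sum>l<Suc m. L $$ (k, l) * P l i - L $$ (k, l) * P l j)"
      using that by (subst mult_vec_entry[OF v]) (auto simp: right_diff_distrib)
    also have "\<dots> = (if k = i then 1 else 0) - (if k = j then 1 else 0)"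
      using that ij by (simp only: sum_subtractf L_mult_P)
    finally show ?thesis using that ij by simp
  qed
  \<comment> \<open>Both sides of the claim have total 0, the left one because the columns of
    \<open>L\<close> sum to zero. Agreement in the first \<open>m\<close> entries therefore forces
    agreement in entry \<open>m\<close>.\<close>
  have "(\<Sum>k<Suc m. (L *\<^sub>v ?v) $ k) = (\<Sum>k<Suc m. \<Sum>l<Suc m. L $$ (k, l) * ?v $ l)"
    by (intro sum.cong refl) (simp only: lessThan_iff mult_vec_entry[OF v])
  also have "\<dots> = (\<Sum>l<Suc m. (\<Sum>k<Suc m. L $$ (k, l)) * ?v $ l)"
    by (subst sum.swap) (simp only: sum_distrib_right)
  also have "\<dots> = 0" by (intro sum.neutral ballI) (simp only: lessThan_iff column_sum mult_zero_left)
  finally have Lv0: "(\<Sum>k<Suc m. (L *\<^sub>v ?v) $ k) = 0" .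
  have "(\<Sum>k<Suc m. ?e $ k) = (\<Sum>k<Suc m. (if k = i then 1 else 0) - (if k = j then 1 else 0))"
    using ij by (intro sum.cong refl) auto
  also have "\<dots> = 0" using ij by (simp only: sum_subtractf sum.delta finite_lessThan) simp
  finally have e0: "(\<Sum>k<Suc m. ?e $ k) = 0" .
  have "(\<Sum>k<m. (L *\<^sub>v ?v) $ k) = (\<Sum>k<m. ?e $ k)"
    by (intro sum.cong refl) (simp only: lessThan_iff inner)
  then have last: "(L *\<^sub>v ?v) $ m = ?e $ m"
    using Lv0 e0 by (simp only: sum.lessThan_Suc) (metis add_left_cancel)
  fix k assume "k < dim_vec ?e"
  then have "k < m \<or> k = m" by auto
  then show "(L *\<^sub>v ?v) $ k = ?e $ k" using inner last by blast
qed (use carrier_L in auto)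

text \<open>Zero row sums allow the potential to be shifted to 0 at \<open>m\<close>. The shifted
  vector then solves the reduced system, and the left inverse recovers it without any division in
  the ring.\<close>

lemma potential_unique:
  assumes v: "v \<in> carrier_vec (Suc m)" and ij: "i < Suc m" "j < Suc m"
    and Lv: "L *\<^sub>v v = of_real Y \<cdot>\<^sub>v (unit_vec (Suc m) i - unit_vec (Suc m) j)"
    and k: "k < Suc m"
  shows "v $ k - v $ m = of_real Y * (P k i - P k j)"
proof (cases "k = m")
  case True
  then show ?thesis by (simp add: grounded_inverse_def)
next
  case False
  then have k: "k < m" using k by simp
  define w where "w l = v $ l - v $ m" for l
  define \<delta> :: "nat \<Rightarrow> nat \<Rightarrow> 'a" where "\<delta> r i = (if r = i then 1 else 0)" for r i
  have Lw: "(\<Sum>l<m. L $$ (r, l) * w l) = of_real Y * (\<delta> r i - \<delta> r j)" if r: "r < m" for r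
  proof -
    \<comment> \<open>The added summand is 0 because \<open>w m = 0\<close>.\<close>
    have "(\<Sum>l<m. L $$ (r, l) * w l) = (\<Sum>l<Suc m. L $$ (r, l) * w l)"
      by (simp add: w_def)
    also have "\<dots> = (\<Sum>l<Suc m. L $$ (r, l) * v $ l) - (\<Sum>l<Suc m. L $$ (r, l)) * v $ m"
      by (simp only: w_def right_diff_distrib sum_subtractf sum_distrib_right)
    also have "\<dots> = (L *\<^sub>v v) $ r"
      using r by (simp only: row_sum mult_vec_entry[OF v] less_SucI) simp
    finally show ?thesis using r ij Lv by (simp add: \<delta>_def)
  qed
  have XP: "(\<Sum>r<m. X $$ (k, r) * \<delta> r i) = P k i" if "i < Suc m" for i
    using that k by (auto simp: \<delta>_def grounded_inverse_def if_distrib cong: if_cong)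
  \<comment> \<open>The identity matrix in front of \<open>w\<close> is replaced by the left inverse
    times the reduced Laplacian, and the sums are regrouped.\<close>
  have "w k = (\<Sum>l<m. (if k = l then 1 else 0) * w l)"
    using k by (simp add: if_distrib[of "\<lambda>x. x * _"] cong: if_cong)
  also have "\<dots> = (\<Sum>l<m. \<Sum>r<m. X $$ (k, r) * (L $$ (r, l) * w l))"
    using k by (intro sum.cong refl)
      (simp only: lessThan_iff left_inverse_entry[symmetric] sum_distrib_right mult.assoc)
  also have "\<dots> = (\<Sum>r<m. X $$ (k, r) * (\<Sum>l<m. L $$ (r, l) * w l))"
    by (subst sum.swap) (simp only: sum_distrib_left)
  also have "\<dots> = (\<Sum>r<m. X $$ (k, r) * (of_real Y * (\<delta> r i - \<delta> r j)))"
    by (intro sum.cong refl) (simp only: lessThan_iff Lw)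
  also have "\<dots> = of_real Y * ((\<Sum>r<m. X $$ (k, r) * \<delta> r i) - (\<Sum>r<m. X $$ (k, r) * \<delta> r j))"
    by (simp add: sum_distrib_left sum_subtractf algebra_simps)
  finally show ?thesis using ij by (simp only: XP w_def)
qed

lemma eff_resistance_eq:
  assumes ij: "i < Suc m" "j < Suc m"
  shows "eff_resistance L i j = P i i + P j j - 2 * P i j"
proof (cases "i = j")
  case True
  then show ?thesis by (simp add: eff_resistance_def)
next
  case False
  have dim: "dim_row L = Suc m" using carrier_L by simp
  have "(THE r. \<exists>Y>0. \<exists>v \<in> carrier_vec (Suc m).
       L *\<^sub>v v = of_real Y \<cdot>\<^sub>v (unit_vec (Suc m) i - unit_vec (Suc m) j) \<and>
       r = (v $ i - v $ j) /\<^sub>R Y) = P i i + P j j - 2 * P i j"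
  proof (rule the_equality)
    show "\<exists>Y>0. \<exists>v \<in> carrier_vec (Suc m).
       L *\<^sub>v v = of_real Y \<cdot>\<^sub>v (unit_vec (Suc m) i - unit_vec (Suc m) j) \<and>
       P i i + P j j - 2 * P i j = (v $ i - v $ j) /\<^sub>R Y"
      \<comment> \<open>Unit current \<open>Y = 1\<close> with the superposed potential gives
        \<open>(P i i - P i j) - (P j i - P j j)\<close>.\<close>
      using ij potential_exists[OF ij] P_sym[of i j]
      by (intro exI[of _ 1] conjI bexI[of _ "vec (Suc m) (\<lambda>k. P k i - P k j)"]) auto
  next
    fix r assume "\<exists>Y>0. \<exists>v \<in> carrier_vec (Suc m).
       L *\<^sub>v v = of_real Y \<cdot>\<^sub>v (unit_vec (Suc m) i - unit_vec (Suc m) j) \<and>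
       r = (v $ i - v $ j) /\<^sub>R Y"
    then obtain Y v where Y: "Y > 0" and v: "v \<in> carrier_vec (Suc m)"
      and Lv: "L *\<^sub>v v = of_real Y \<cdot>\<^sub>v (unit_vec (Suc m) i - unit_vec (Suc m) j)"
      and r: "r = (v $ i - v $ j) /\<^sub>R Y" by blast
    \<comment> \<open>Measuring both potentials from vertex \<open>m\<close> makes the uniqueness
      result applicable; the positive real \<open>Y\<close> then cancels.\<close>
    have "v $ i - v $ j = (v $ i - v $ m) - (v $ j - v $ m)" by simp
    also have "\<dots> = of_real Y * (P i i - P i j) - of_real Y * (P j i - P j j)"
      using potential_unique[OF v ij Lv] ij by (simp only:)
    also have "\<dots> = Y *\<^sub>R (P i i + P j j - 2 * P i j)"
      using P_sym[of i j] by (simp add: scaleR_conv_of_real algebra_simps)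
    finally show "r = P i i + P j j - 2 * P i j" using r Y by simp
  qed
  then show ?thesis using False by (simp only: eff_resistance_def dim if_False)
qed

text \<open>Each diagonal entry lies in \<open>n - 1\<close> pairs, and the full double sum contains
  the diagonal once more besides every mixed entry twice. This accounts for the factor
  \<open>n\<close>.\<close>

lemma sum_pairs_eq:
  "(\<Sum>j<n. \<Sum>i<j. P i i + P j j - 2 * P i j)
    = of_nat n * (\<Sum>i<n. P i i) - (\<Sum>i<n. \<Sum>j<n. P i j)"
proof (induction n)
  case (Suc n)
  have "(\<Sum>j<n. P n j) = (\<Sum>i<n. P i n)" by (intro sum.cong refl P_sym)
  with Suc show ?case
    by (simp add: sum.distrib sum_subtractf sum_distrib_left[symmetric] algebra_simps)
qed simp

text \<open>Row and column \<open>m\<close> of \<open>P\<close> vanish, so the sums shrink to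
  \<open>X\<close>, while the factor remains the number of vertices \<open>Suc m\<close>.\<close>

lemma kirchhoff_index_eq:
  "kirchhoff_index L = of_nat (Suc m) * mat_trace X - (\<Sum>i<m. \<Sum>j<m. X $$ (i, j))"
proof -
  have "kirchhoff_index L = (\<Sum>j<Suc m. \<Sum>i<j. P i i + P j j - 2 * P i j)"
    unfolding kirchhoff_index_def using carrier_L
    by (intro sum.cong) (auto intro!: eff_resistance_eq)
  also have "\<dots> = of_nat (Suc m) * (\<Sum>i<Suc m. P i i) - (\<Sum>i<Suc m. \<Sum>j<Suc m. P i j)"
    by (rule sum_pairs_eq)
  also have "(\<Sum>i<Suc m. P i i) = mat_trace X"
    using carrier_X by (simp add: mat_trace_def grounded_inverse_def)
  also have "(\<Sum>i<Suc m. \<Sum>j<Suc m. P i j) = (\<Sum>i<m. \<Sum>j<m. X $$ (i, j))"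
    by (simp add: grounded_inverse_def)
  finally show ?thesis .
qed

end

section \<open>Graph Laplacians\<close>

lemma weighted_laplacian_carrier: "weighted_laplacian n E w \<in> carrier_mat n n"
  by (auto simp: weighted_laplacian_def degree_mat_def adjacency_mat_def)

lemma weighted_laplacian_index:
  assumes "i < n" "j < n"
  shows "weighted_laplacian n E w $$ (i, j) =
    (if i = j then \<Sum>k<n. if {i, k} \<in> E then w {i, k} else 0 else 0)
    - (if {i, j} \<in> E then w {i, j} else 0)"
  using assms
  by (auto simp: weighted_laplacian_def degree_mat_def adjacency_mat_def mat_diag_def)

lemma weighted_laplacian_sym:
  assumes "i < n" "j < n"
  shows "weighted_laplacian n E w $$ (i, j) = weighted_laplacian n E w $$ (j, i)"
  using assms by (auto simp: weighted_laplacian_index insert_commute)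

lemma weighted_laplacian_row_sum:
  assumes "i < n"
  shows "(\<Sum>j<n. weighted_laplacian n E w $$ (i, j)) = 0"
  using assms by (simp add: weighted_laplacian_index sum_subtractf)

section \<open>The Dirichlet form and invertibility of the reduced Laplacian\<close>

lemma laplacian_quadratic_form:
  fixes x :: "nat \<Rightarrow> real"
  shows "2 * (\<Sum>i<n. x i * (\<Sum>j<n. laplacian n E $$ (i, j) * x j))
    = (\<Sum>i<n. \<Sum>j<n. if {i, j} \<in> E then (x i - x j)\<^sup>2 else 0)"
proof -
  define A :: "nat \<Rightarrow> nat \<Rightarrow> real" where "A i j = (if {i, j} \<in> E then 1 else 0)" for i j
  have A_sym: "A i j = A j i" for i j by (simp add: A_def insert_commute)
  have row: "(\<Sum>j<n. laplacian n E $$ (i, j) * x j) = (\<Sum>j<n. A i j * (x i - x j))"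
    if "i < n" for i
  proof -
    have "(\<Sum>j<n. laplacian n E $$ (i, j) * x j)
        = (\<Sum>j<n. (if i = j then (\<Sum>k<n. A i k) * x j else 0) - A i j * x j)"
      using that by (intro sum.cong refl)
        (auto simp: laplacian_def weighted_laplacian_index A_def algebra_simps)
    also have "\<dots> = (\<Sum>k<n. A i k) * x i - (\<Sum>j<n. A i j * x j)"
      using that by (simp add: sum_subtractf)
    finally show ?thesis by (simp add: sum_distrib_right sum_subtractf right_diff_distrib)
  qed
  define S where "S = (\<Sum>i<n. \<Sum>j<n. x i * (A i j * (x i - x j)))"
  have "(\<Sum>i<n. x i * (\<Sum>j<n. laplacian n E $$ (i, j) * x j)) = S"
    by (simp add: S_def row sum_distrib_left)
  \<comment> \<open>Adding the copy of \<open>S\<close> with the roles of \<open>i\<close> and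
    \<open>j\<close> exchanged completes the square on each ordered pair.\<close>
  moreover have "S = (\<Sum>i<n. \<Sum>j<n. x j * (A j i * (x j - x i)))"
    unfolding S_def by (rule sum.swap)
  then have "2 * S = (\<Sum>i<n. \<Sum>j<n. x i * (A i j * (x i - x j)) + x j * (A j i * (x j - x i)))"
    by (simp add: sum.distrib) (simp add: S_def)
  moreover have "x i * (A i j * (x i - x j)) + x j * (A j i * (x j - x i))
      = (if {i, j} \<in> E then (x i - x j)\<^sup>2 else 0)" for i j
    unfolding A_sym[of j i] by (simp add: A_def power2_eq_square algebra_simps)
  ultimately show ?thesis by simp
qed

lemma laplacian_kernel_const:
  assumes simple: "simple_graph n E" and conn: "connected_graph n E"
    and ker: "\<And>i. i < n \<Longrightarrow> (\<Sum>j<n. laplacian n E $$ (i, j) * x j) = 0"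
    and uv: "u < n" "v < n"
  shows "x u = x v"
proof -
  define f where "f i j = (if {i, j} \<in> E then (x i - x j)\<^sup>2 else 0)" for i j
  have nonneg: "f i j \<ge> 0" for i j by (simp add: f_def)
  have "(\<Sum>i<n. \<Sum>j<n. f i j) = 0"
    using laplacian_quadratic_form[of x n E] ker by (simp add: f_def)
  then have f0: "f i j = 0" if "i < n" "j < n" for i j
    using that by (simp add: sum_nonneg_eq_0_iff sum_nonneg nonneg)
  \<comment> \<open>Simplicity of the graph places both endpoints below \<open>n\<close>, where the
    vanishing summand \<open>f i j\<close> gives equality. Equality then spreads along
    paths.\<close>
  have edge: "x i = x j" if "{i, j} \<in> E" for i j
    using that simple f0[of i j] by (auto simp: f_def simple_graph_def)
  have "(u, v) \<in> {(x, y). {x, y} \<in> E}\<^sup>*"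
    using conn uv by (auto simp: connected_graph_def)
  then show ?thesis by induction (auto dest: edge)
qed

lemma reduced_laplacian_invertible:
  assumes simple: "simple_graph (Suc m) E" and conn: "connected_graph (Suc m) E"
  shows "invertible_mat (mat_delete (laplacian (Suc m) E) m m)"
proof -
  let ?L = "laplacian (Suc m) E"
  let ?A = "mat_delete ?L m m"
  have L: "?L \<in> carrier_mat (Suc m) (Suc m)"
    by (simp add: laplacian_def weighted_laplacian_carrier)
  then have A: "?A \<in> carrier_mat m m" by (auto simp: mat_delete_def)
  have "det ?A \<noteq> 0"
  proof
    assume "det ?A = 0"
    then obtain v where v: "v \<in> carrier_vec m" "v \<noteq> 0\<^sub>v m" "?A *\<^sub>v v = 0\<^sub>v m"
      using det_0_iff_vec_prod_zero_field[OF A] by blast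
    \<comment> \<open>The value 0 at \<open>m\<close> matters twice: it keeps the reduced equations
      intact, and it is the constant to which all entries will be equal.\<close>
    define x where "x k = (if k < m then v $ k else 0)" for k
    have inner: "(\<Sum>j<Suc m. ?L $$ (i, j) * x j) = 0" if i: "i < m" for i
    proof -
      have "(\<Sum>j<Suc m. ?L $$ (i, j) * x j) = (\<Sum>j<m. ?A $$ (i, j) * v $ j)"
        using i L by (simp add: x_def mat_delete_def)
      also have "\<dots> = (?A *\<^sub>v v) $ i"
        using i by (intro mult_mat_vec_index_sum[OF A v(1), symmetric])
      finally show ?thesis using i v(3) by simp
    qed
    \<comment> \<open>The kernel equation in the last row is not given; it follows from the other
      rows because the columns sum to zero.\<close>
    have "(\<Sum>i<Suc m. \<Sum>j<Suc m. ?L $$ (i, j) * x j)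
        = (\<Sum>j<Suc m. (\<Sum>i<Suc m. ?L $$ (j, i)) * x j)"
      by (subst sum.swap, unfold sum_distrib_right, intro sum.cong refl)
        (simp add: laplacian_def weighted_laplacian_sym)
    also have "\<dots> = 0"
      by (intro sum.neutral ballI)
        (simp only: laplacian_def weighted_laplacian_row_sum lessThan_iff mult_zero_left)
    finally have total: "(\<Sum>i<Suc m. \<Sum>j<Suc m. ?L $$ (i, j) * x j) = 0" .
    have "(\<Sum>i<m. \<Sum>j<Suc m. ?L $$ (i, j) * x j) = 0"
      using inner by (simp del: sum.lessThan_Suc)
    with total have "(\<Sum>j<Suc m. ?L $$ (m, j) * x j) = 0"
      by (subst (asm) sum.lessThan_Suc) simp
    with inner have "(\<Sum>j<Suc m. ?L $$ (i, j) * x j) = 0" if "i < Suc m" for i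
      using that less_Suc_eq by metis
    then have "x k = x m" if "k < m" for k
      using that by (intro laplacian_kernel_const[OF simple conn]) auto
    then have "v = 0\<^sub>v m" using v(1) by (intro eq_vecI) (auto simp: x_def)
    with v(2) show False by simp
  qed
  then obtain B where "B \<in> carrier_mat m m" "?A * B = 1\<^sub>m m" "B * ?A = 1\<^sub>m m"
    using det_non_zero_imp_unit[OF A, of "()"] by (auto simp: Units_def ring_mat_simps)
  then show ?thesis using A unfolding invertible_mat_def inverts_mat_def
    by (metis carrier_matD square_mat.simps)
qed

section \<open>Resistances and Kirchhoff indices of the graph and its dual weighting\<close>

lemma ones_vec_quadratic_form:
  fixes A :: "'a::comm_ring_1 mat"
  assumes "A \<in> carrier_mat m m"
  shows "ones_vec m \<bullet> (A *\<^sub>v ones_vec m) = (\<Sum>i<m. \<Sum>j<m. A $$ (i, j))"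
  using assms by (simp add: ones_vec_def scalar_prod_def lessThan_atLeast0)

theorem theorem3p5:
  fixes n :: nat and E :: "nat set set" and a :: "nat set \<Rightarrow> real"
    and L11 Lh11 :: "real mat"
  assumes "n \<ge> 1"
    and "simple_graph n E"
    and "connected_graph n E"
    and "L11 \<in> carrier_mat (n - 1) (n - 1)"
    and "Lh11 \<in> carrier_mat (n - 1) (n - 1)"
    and "mat_delete (dual_laplacian n E a) (n - 1) (n - 1) = dual_mat L11 Lh11"
  shows "invertible_mat L11 \<and>
    (let M = mat_inv L11; N = mat_inv L11 * Lh11 * mat_inv L11;
         G = laplacian n E; Gw = dual_laplacian n E a; u = ones_vec (n - 1)
     in
      (\<forall>i < n - 1. \<forall>j < n - 1.
         eff_resistance Gw i j =
           of_real (M $$ (i, i) + M $$ (j, j) - 2 * M $$ (i, j))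
           - of_real (N $$ (i, i) + N $$ (j, j) - 2 * N $$ (i, j)) * eps
         \<and> M $$ (i, i) + M $$ (j, j) - 2 * M $$ (i, j) = eff_resistance G i j)
      \<and> (\<forall>i < n - 1.
         eff_resistance Gw i (n - 1) = of_real (M $$ (i, i)) - of_real (N $$ (i, i)) * eps
         \<and> M $$ (i, i) = eff_resistance G i (n - 1))
      \<and> (kirchhoff_index Gw =
           of_real (real n * mat_trace M - u \<bullet> (M *\<^sub>v u))
           - of_real (real n * mat_trace N - u \<bullet> (N *\<^sub>v u)) * eps
         \<and> real n * mat_trace M - u \<bullet> (M *\<^sub>v u) = kirchhoff_index G))"
proof -
  define m where "m = n - 1"
  define M where "M = mat_inv L11"
  define N where "N = M * Lh11 * M"
  let ?G = "laplacian n E" and ?Gw = "dual_laplacian n E a"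
  have n: "n = Suc m" using assms(1) by (simp add: m_def)
  have c: "L11 \<in> carrier_mat m m" "Lh11 \<in> carrier_mat m m"
    using assms(4,5) by (simp_all add: m_def)
  \<comment> \<open>Standard and dual parts are unique, so \<open>L11\<close> is the reduced
    Laplacian of the unweighted graph.\<close>
  have L11: "L11 = mat_delete ?G m m"
    using mat_delete_dual_laplacian_iff[of n L11 Lh11 E a] assms by (simp add: m_def)
  have inv: "invertible_mat L11"
    using reduced_laplacian_invertible[of m E] assms(2,3) L11 n by simp
  have M: "M \<in> carrier_mat m m" "L11 * M = 1\<^sub>m m" "M * L11 = 1\<^sub>m m"
    using mat_inv[OF c(1) inv] by (simp_all add: M_def)
  have N: "N \<in> carrier_mat m m" using M(1) c by (simp add: N_def)
  have Gw_delete: "mat_delete ?Gw m m = dual_mat L11 Lh11"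
    using assms(6) by (simp add: m_def)
  \<comment> \<open>This is the inverse of \<open>dual_mat L11 Lh11\<close>.\<close>
  define X where "X = dual_mat M (- N)"
  have X_index: "X $$ (i, j) = of_real (M $$ (i, j)) - of_real (N $$ (i, j)) * eps"
    if "i < m" "j < m" for i j
    using that M(1) N by (simp add: X_def dual_mat_index[of M m m "- N"])
  interpret G: grounded_laplacian m ?G M
    using M weighted_laplacian_carrier[of n E] weighted_laplacian_sym[of _ n _ E]
      weighted_laplacian_row_sum[of _ n E] L11
    unfolding laplacian_def n by unfold_locales (auto simp del: sum.lessThan_Suc)
  interpret Gw: grounded_laplacian m ?Gw X
  proof
    show "mat_delete ?Gw m m * X = 1\<^sub>m m" "X * mat_delete ?Gw m m = 1\<^sub>m m"
      using dual_mat_inverse[OF c M] by (simp_all add: Gw_delete X_def N_def)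
    show "X \<in> carrier_mat m m" using M(1) N by (simp add: X_def)
  qed (use weighted_laplacian_carrier[of n E] weighted_laplacian_sym[of _ n _ E]
      weighted_laplacian_row_sum[of _ n E] n
      in \<open>auto simp: dual_laplacian_conductance simp del: sum.lessThan_Suc\<close>)
  have trace: "mat_trace X = of_real (mat_trace M) - of_real (mat_trace N) * eps"
    using M(1) N Gw.carrier_X
    by (simp add: mat_trace_def X_index sum_subtractf sum_distrib_right)
  have total: "(\<Sum>i<m. \<Sum>j<m. X $$ (i, j)) = of_real (\<Sum>i<m. \<Sum>j<m. M $$ (i, j))
      - of_real (\<Sum>i<m. \<Sum>j<m. N $$ (i, j)) * eps"
    by (simp add: X_index sum_subtractf sum_distrib_right)
  have "eff_resistance ?Gw i j =
           of_real (M $$ (i, i) + M $$ (j, j) - 2 * M $$ (i, j))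
           - of_real (N $$ (i, i) + N $$ (j, j) - 2 * N $$ (i, j)) * eps
         \<and> M $$ (i, i) + M $$ (j, j) - 2 * M $$ (i, j) = eff_resistance ?G i j"
    if "i < m" "j < m" for i j
    using that
    by (simp add: G.eff_resistance_eq Gw.eff_resistance_eq grounded_inverse_def X_index
        algebra_simps)
  \<comment> \<open>Here the second vertex is the ground, where \<open>P\<close> vanishes, so only
    the diagonal term at \<open>i\<close> survives.\<close>
  moreover have "eff_resistance ?Gw i m = of_real (M $$ (i, i)) - of_real (N $$ (i, i)) * eps
         \<and> M $$ (i, i) = eff_resistance ?G i m"
    if "i < m" for i
    using that
    by (simp add: G.eff_resistance_eq Gw.eff_resistance_eq grounded_inverse_def X_index)
  moreover have "kirchhoff_index ?Gw =
           of_real (real n * mat_trace M - ones_vec m \<bullet> (M *\<^sub>v ones_vec m))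
           - of_real (real n * mat_trace N - ones_vec m \<bullet> (N *\<^sub>v ones_vec m)) * eps
         \<and> real n * mat_trace M - ones_vec m \<bullet> (M *\<^sub>v ones_vec m) = kirchhoff_index ?G"
    unfolding G.kirchhoff_index_eq Gw.kirchhoff_index_eq trace total
      ones_vec_quadratic_form[OF M(1)] ones_vec_quadratic_form[OF N] n[symmetric]
    by (simp add: algebra_simps del: of_nat_Suc of_real_sum)
  ultimately show ?thesis
    using inv unfolding Let_def M_def[symmetric] N_def[symmetric] m_def[symmetric] by blast
qed

end
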